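(* Let $p>1$. For $f\in\mathcal E^p$ and $N\ge0$, define the level-$N$ Faber--Schauder truncation by $$\Pi_Nf(t):=f(0)+\sum_{n=-1}^{N-1}\sum_{k\in I_n}\theta^f_{n,k}e_{n,k}(t),\qquad t\in[0,1].$$ Then $\|f-\Pi_Nf\|_{\mathcal E^p}\to0$ as $N\to\infty$. In particular, finite Faber--Schauder expansions (that is, functions of the form $c+\sum_{n=-1}^{N-1}\sum_{k\in I_n}a_{n,k}e_{n,k}$ with $N\ge0$ and $c,a_{n,k}\in\mathbb R$) are dense in $\mathcal E^p$.
   Context: $C([0,1])$ denotes the real-valued continuous functions on $[0,1]$, $\|\cdot\|_\infty$ the uniform norm. $\mathbb N_0=\{0,1,2,\dots\}$, $\mathbb N_{-1}=\{-1,0,1,\dots\}$. For $n\in\mathbb N_0$: $t_{n,k}=k2^{-n}$ for $0\le k\le 2^n$, $I_n=\{0,\dots,2^n-1\}$; also $I_{-1}=\{0\}$. Haar and Faber--Schauder functions: $\psi=1$ on $[0,\frac12)$, $\psi=-1$ on $[\frac12,1)$, $\psi=0$ otherwise; $\psi_{n,k}(t)=2^{n/2}\psi(2^nt-k)$ for $n\ge0$, $k\in I_n$; $\psi_{-1,0}(t)=1$ on $[0,1]$; $e_{n,k}(t)=\int_0^t\psi_{n,k}(s)\,ds$ for $n\in\mathbb N_{-1}$, $k\in I_n$. Faber--Schauder coefficients of $f\in C([0,1])$: $\theta^f_{-1,0}=f(1)-f(0)$, and for $n\ge0$, $k\in I_n$, $\theta^f_{n,k}=2^{n/2}\big(2f(t_{n+1,2k+1})-f(t_{n,k})-f(t_{n,k+1})\big)$.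 Level energies ($p>1$): $\zeta_f^{(p)}(-1)=2^{1-\frac1p}|\theta^f_{-1,0}|$ and $\zeta_f^{(p)}(n)=\big(2^{-np/2}\sum_{k\in I_n}|\theta^f_{n,k}|^p\big)^{1/p}$ for $n\ge0$. Schauder tail sequence: $H_f(n)=\sum_{m=n}^\infty 2^{-m/2}\sup_{k\in I_m}|\theta^f_{m,k}|\in[0,\infty]$ for $n\ge0$. Energy space ($p>1$): $\|f\|_{\mathcal E^p}=\|f\|_\infty+\|\zeta_f^{(p)}\|_{\ell^p(\mathbb N_{-1})}+\|H_f\|_{\ell^p(\mathbb N_0)}$ and $\mathcal E^p=\{f\in C([0,1]):\|f\|_{\mathcal E^p}<\infty\}$. *)

theory Defs
  imports "HOL-Analysis.Analysis"
begin

text \<open>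
  Levels are integers \<open>n \<ge> -1\<close>. Elements of \<open>C([0,1])\<close> are functions \<open>real \<Rightarrow> real\<close> that are
  continuous on \<open>{0..1}\<close>; every quantity below depends only on their values on \<open>{0..1}\<close>.
\<close>

definition dyadic :: "int \<Rightarrow> nat \<Rightarrow> real" where
  "dyadic n k = real k * 2 powi (- n)"

definition level_index :: "int \<Rightarrow> nat set" where
  "level_index n = (if n = -1 then {0} else {..< 2 ^ nat n})"

definition haar_mother :: "real \<Rightarrow> real" where
  "haar_mother t = (if 0 \<le> t \<and> t < 1/2 then 1 else if 1/2 \<le> t \<and> t < 1 then -1 else 0)"

definition haar :: "int \<Rightarrow> nat \<Rightarrow> real \<Rightarrow> real" where
  "haar n k t = (if n = -1 then indicator {0..1} t
                 else 2 powr (of_int n / 2) * haar_mother (2 powi n * t - real k))"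

definition schauder :: "int \<Rightarrow> nat \<Rightarrow> real \<Rightarrow> real" where
  "schauder n k t = integral {0..t} (haar n k)"

definition schauder_coeff :: "(real \<Rightarrow> real) \<Rightarrow> int \<Rightarrow> nat \<Rightarrow> real" where
  "schauder_coeff f n k =
     (if n = -1 then f 1 - f 0
      else 2 powr (of_int n / 2) *
             (2 * f (dyadic (n + 1) (2 * k + 1)) - f (dyadic n k) - f (dyadic n (k + 1))))"

definition level_energy :: "real \<Rightarrow> (real \<Rightarrow> real) \<Rightarrow> int \<Rightarrow> real" where
  "level_energy p f n =
     (if n = -1 then 2 powr (1 - 1 / p) * \<bar>schauder_coeff f (-1) 0\<bar>
      else (2 powr (- of_int n * p / 2) *
             (\<Sum>k\<in>level_index n. \<bar>schauder_coeff f n k\<bar> powr p)) powr (1 / p))"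

definition schauder_tail :: "(real \<Rightarrow> real) \<Rightarrow> nat \<Rightarrow> ennreal" where
  "schauder_tail f n =
     (\<Sum>\<^sub>\<infinity>m\<in>{n..}. ennreal (2 powr (- real m / 2)) *
        (SUP k\<in>level_index (int m). ennreal \<bar>schauder_coeff f (int m) k\<bar>))"

text \<open>Real powers on \<open>[0,\<infinity>]\<close>, intended for exponents \<open>a > 0\<close>.\<close>

definition ennreal_powr :: "ennreal \<Rightarrow> real \<Rightarrow> ennreal" where
  "ennreal_powr x a = (if x = \<infinity> then \<infinity> else ennreal (enn2real x powr a))"

definition lp_norm :: "real \<Rightarrow> 'a set \<Rightarrow> ('a \<Rightarrow> ennreal) \<Rightarrow> ennreal" where
  "lp_norm p A a = ennreal_powr (\<Sum>\<^sub>\<infinity>x\<in>A. ennreal_powr (a x) p) (1 / p)"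

definition sup_norm :: "(real \<Rightarrow> real) \<Rightarrow> ennreal" where
  "sup_norm f = (SUP t\<in>{0..1}. ennreal \<bar>f t\<bar>)"

definition energy_norm :: "real \<Rightarrow> (real \<Rightarrow> real) \<Rightarrow> ennreal" where
  "energy_norm p f =
     sup_norm f + lp_norm p {-1..} (\<lambda>n. ennreal (level_energy p f n))
       + lp_norm p UNIV (schauder_tail f)"

definition energy_space :: "real \<Rightarrow> (real \<Rightarrow> real) set" where
  "energy_space p = {f. continuous_on {0..1} f \<and> energy_norm p f < \<infinity>}"

definition schauder_sum :: "nat \<Rightarrow> real \<Rightarrow> (int \<Rightarrow> nat \<Rightarrow> real) \<Rightarrow> real \<Rightarrow> real" where
  "schauder_sum N c a t =
     c + (\<Sum>n\<in>{-1..int N - 1}. \<Sum>k\<in>level_index n. a n k * schauder n k t)"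

definition schauder_trunc :: "nat \<Rightarrow> (real \<Rightarrow> real) \<Rightarrow> real \<Rightarrow> real" where
  "schauder_trunc N f = schauder_sum N (f 0) (schauder_coeff f)"

definition finite_schauder_expansions :: "(real \<Rightarrow> real) set" where
  "finite_schauder_expansions = {g. \<exists>N c a. \<forall>t\<in>{0..1}. g t = schauder_sum N c a t}"

end

theory Submission
  imports Defs
begin

text \<open>
  The Faber--Schauder functions are rescaled tents, and the coefficient functionals are
  biorthogonal to them (\<open>schauder_coeff_schauder\<close>): a second difference at level \<open>n\<close> annihilates a
  tent of a strictly coarser level, because that tent is affine on every dyadic interval of level
  \<open>n\<close>, and it only sees zeros of a tent of a strictly finer level. Hence the remainder
  \<open>f - \<Pi>\<^sub>N f\<close> has exactly the coefficients of \<open>f\<close> from level \<open>N\<close> on, and zeros below.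

  Each of the three parts of the energy norm of the remainder is therefore explicit. Its level
  energies are those of \<open>f\<close>, cut off below \<open>N\<close>, and its tail sequence is \<open>n \<mapsto> H\<^sub>f (max n N)\<close>. Both are
  dominated by the sequences of \<open>f\<close>, which lie in \<open>\<ell>\<^sup>p\<close>, and both tend to \<open>0\<close> pointwise in \<open>n\<close>:
  the first is eventually \<open>0\<close>, and for the second \<open>H\<^sub>f N \<longlonglongrightarrow> 0\<close> since \<open>H\<^sub>f 0\<close> is a convergent series.
  Dominated convergence (\<open>lp_norm_dominated_tendsto_0\<close>) makes both \<open>\<ell>\<^sup>p\<close> norms vanish in the limit.

  The uniform norm needs no separate interpolation argument. Passing from the dyadic points of
  level \<open>n\<close> to those of level \<open>n + 1\<close> increases the maximum of \<open>\<bar>g\<bar>\<close> over these points by at most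
  the \<open>n\<close>th term of the Schauder tail, so that a continuous \<open>g\<close> satisfies
  \<open>\<parallel>g\<parallel>\<^sub>\<infinity> \<le> max \<bar>g 0\<bar> \<bar>g 1\<bar> + H\<^sub>g 0\<close> (\<open>sup_norm_le_schauder_tail\<close>). The remainder vanishes at both
  endpoints, so its uniform norm is at most \<open>H\<^sub>f N\<close>.

  A finite expansion is continuous and has only finitely many nonzero level terms, all of them
  finite, so it belongs to the energy space. Density is then the convergence of the truncations.
\<close>

section \<open>Dominated convergence for sums and norms in the extended half-line\<close>

lemma ennreal_summable_on [simp]: "(f :: 'a \<Rightarrow> ennreal) summable_on A"
  by (simp add: nonneg_summable_on_complete)

text \<open>
  A finite subset \<open>F\<close> carries all but \<open>d\<close> of the sum of the majorant. The sum over \<open>F\<close>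
  tends to \<open>0\<close> termwise, and the sum over the complement stays below \<open>d\<close> uniformly in \<open>N\<close>.
\<close>

lemma infsum_ennreal_dominated_tendsto_0:
  fixes u :: "nat \<Rightarrow> 'a \<Rightarrow> ennreal"
  assumes bound: "\<And>N x. x \<in> A \<Longrightarrow> u N x \<le> w x"
    and fin: "(\<Sum>\<^sub>\<infinity>x\<in>A. w x) < \<infinity>"
    and lim: "\<And>x. x \<in> A \<Longrightarrow> (\<lambda>N. u N x) \<longlonglongrightarrow> 0"
  shows "(\<lambda>N. \<Sum>\<^sub>\<infinity>x\<in>A. u N x) \<longlonglongrightarrow> 0"
proof (rule order_tendstoI)
  fix e :: ennreal assume "0 < e"
  then obtain r where r: "0 < r" "r < e" using dense by blast
  then obtain x where x: "r = ennreal x" "0 < x"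
    by (metis ennreal_cases ennreal_less_zero_iff not_top_less)
  define d where "d = ennreal (x / 2)"
  have d: "0 < d" "d + d = r"
    using x by (simp_all add: d_def flip: ennreal_plus)
  let ?W = "\<Sum>\<^sub>\<infinity>x\<in>A. w x"
  have "((\<lambda>F. sum w F + d) \<longlongrightarrow> ?W + d) (finite_subsets_at_top A)"
    by (intro tendsto_intros infsum_tendsto) simp
  moreover have "?W < ?W + d"
    using fin d by (metis add.right_neutral ennreal_add_left_cancel_less infinity_ennreal_def less_top)
  ultimately have "\<forall>\<^sub>F F in finite_subsets_at_top A. ?W < sum w F + d"
    by (rule order_tendstoD)
  then obtain F where F: "finite F" "F \<subseteq> A" "?W < sum w F + d"
    by (metis (mono_tags, lifting) eventually_finite_subsets_at_top subset_refl)
  have split: "infsum v A = sum v F + infsum v (A - F)" for v :: "'a \<Rightarrow> ennreal"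
    using infsum_Un_disjoint[of v F "A - F"] F by (simp add: Un_absorb1)
  have tail: "infsum w (A - F) < d"
    using F(3) by (simp add: split[of w])
  have "(\<lambda>N. sum (u N) F) \<longlonglongrightarrow> (\<Sum>x\<in>F. 0)"
    using F by (intro tendsto_sum lim) auto
  then have "\<forall>\<^sub>F N in sequentially. sum (u N) F < d"
    using d by (intro order_tendstoD) auto
  then show "\<forall>\<^sub>F N in sequentially. infsum (u N) A < e"
  proof eventually_elim
    case (elim N)
    have "infsum (u N) (A - F) \<le> infsum w (A - F)"
      by (intro infsum_mono bound) auto
    then have "infsum (u N) A < d + d"
      unfolding split[of "u N"] using elim tail by (intro add_strict_mono) auto
    with d r show ?case by simp
  qed
qed auto

lemma ennreal_powr_mono:
  assumes "x \<le> y" "0 < a"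
  shows "ennreal_powr x a \<le> ennreal_powr y a"
  using assms unfolding ennreal_powr_def
  by (auto simp: top_unique less_top enn2real_mono intro!: ennreal_leI powr_mono2)

lemma ennreal_powr_less_top [simp]: "ennreal_powr x a < top \<longleftrightarrow> x < top"
  by (auto simp: ennreal_powr_def less_top)

lemma ennreal_powr_0: "ennreal_powr 0 a = 0"
  by (simp add: ennreal_powr_def)

lemma tendsto_0_ennreal_powr:
  assumes u: "(u \<longlongrightarrow> 0) F" and a: "0 < a"
  shows "((\<lambda>x. ennreal_powr (u x) a) \<longlongrightarrow> 0) F"
proof -
  have "((\<lambda>x. enn2real (u x)) \<longlongrightarrow> 0) F"
    using tendsto_enn2real[of u 0 F] u by simp
  then have "((\<lambda>x. enn2real (u x) powr a) \<longlongrightarrow> 0 powr a) F"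
    using a by (intro tendsto_powr') auto
  then have "((\<lambda>x. ennreal (enn2real (u x) powr a)) \<longlongrightarrow> 0) F"
    using tendsto_ennrealI by fastforce
  moreover have "\<forall>\<^sub>F x in F. ennreal (enn2real (u x) powr a) = ennreal_powr (u x) a"
    using order_tendstoD(2)[OF u, of \<infinity>] by (auto simp: ennreal_powr_def elim: eventually_mono)
  ultimately show ?thesis
    by (rule Lim_transform_eventually)
qed

lemma lp_norm_dominated_tendsto_0:
  fixes u :: "nat \<Rightarrow> 'a \<Rightarrow> ennreal"
  assumes p: "0 < p"
    and bound: "\<And>N x. x \<in> A \<Longrightarrow> u N x \<le> w x"
    and fin: "lp_norm p A w < \<infinity>"
    and lim: "\<And>x. x \<in> A \<Longrightarrow> (\<lambda>N. u N x) \<longlonglongrightarrow> 0"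
  shows "(\<lambda>N. lp_norm p A (u N)) \<longlonglongrightarrow> 0"
  unfolding lp_norm_def
  using p fin
  by (intro tendsto_0_ennreal_powr infsum_ennreal_dominated_tendsto_0[where w = "\<lambda>x. ennreal_powr (w x) p"]
      ennreal_powr_mono bound lim)
     (auto simp: lp_norm_def)

lemma lp_norm_finite_imp_finite:
  assumes fin: "lp_norm p A w < \<infinity>" and x: "x \<in> A"
  shows "w x < \<infinity>"
proof -
  have "ennreal_powr (w x) p = (\<Sum>\<^sub>\<infinity>x\<in>{x}. ennreal_powr (w x) p)" by simp
  also have "\<dots> \<le> (\<Sum>\<^sub>\<infinity>x\<in>A. ennreal_powr (w x) p)"
    using x by (intro infsum_mono_neutral) auto
  also have "\<dots> < \<infinity>"
    using fin by (simp add: lp_norm_def)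
  finally show ?thesis by simp
qed

text \<open>
  What puts finite expansions into the energy space: both of their level sequences are finite
  and vanish from some level on.
\<close>

lemma lp_norm_finite_support:
  assumes "finite S" "S \<subseteq> A" "\<And>x. x \<in> A - S \<Longrightarrow> w x = 0" "\<And>x. x \<in> S \<Longrightarrow> w x < \<infinity>"
  shows "lp_norm p A w < \<infinity>"
proof -
  have "(\<Sum>\<^sub>\<infinity>x\<in>A. ennreal_powr (w x) p) = (\<Sum>\<^sub>\<infinity>x\<in>S. ennreal_powr (w x) p)"
    using assms by (intro infsum_cong_neutral) (auto simp: ennreal_powr_0)
  also have "\<dots> < \<infinity>"
    using assms by simp
  finally show ?thesis by (simp add: lp_norm_def)
qed

section \<open>Schauder functions as rescaled tents\<close>

definition tent :: "real \<Rightarrow> real" where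
  "tent x = max 0 (min x (1 - x))"

lemma continuous_on_tent [continuous_intros]:
  "continuous_on A f \<Longrightarrow> continuous_on A (\<lambda>x. tent (f x))"
  unfolding tent_def by (intro continuous_intros)

lemma tent_of_int [simp]: "tent (of_int i) = 0"
  by (cases "i \<le> 0") (auto simp: tent_def)

text \<open>
  The tent is the primitive of the Haar mother wavelet away from its three corners, and
  finitely many exceptional points do not matter for the fundamental theorem of calculus.
\<close>

lemma DERIV_tent:
  assumes "x \<notin> {0, 1/2, 1}"
  shows "(tent has_real_derivative haar_mother x) (at x)"
proof -
  consider "x < 0" | "0 < x" "x < 1/2" | "1/2 < x" "x < 1" | "1 < x"
    using assms by fastforce
  then show ?thesis
  proof cases
    case 1
    show ?thesis
      by (rule has_field_derivative_transform_within_open[where f = "\<lambda>x. 0" and S = "{..<0}"])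
         (use 1 in \<open>auto simp: tent_def haar_mother_def\<close>)
  next
    case 2
    show ?thesis
      by (rule has_field_derivative_transform_within_open[where f = "\<lambda>x. x" and S = "{0<..<1/2}"])
         (use 2 in \<open>auto simp: tent_def haar_mother_def\<close>)
  next
    case 3
    show ?thesis
      by (rule has_field_derivative_transform_within_open[where f = "\<lambda>x. 1 - x" and S = "{1/2<..<1}"])
         (use 3 in \<open>auto simp: tent_def haar_mother_def intro!: derivative_eq_intros\<close>)
  next
    case 4
    show ?thesis
      by (rule has_field_derivative_transform_within_open[where f = "\<lambda>x. 0" and S = "{1<..}"])
         (use 4 in \<open>auto simp: tent_def haar_mother_def\<close>)
  qed
qed

lemma schauder_coarsest:
  assumes "t \<in> {0..1}"
  shows "schauder (-1) k t = t"
proof -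
  have "schauder (-1) k t = integral {0..t} (\<lambda>x. 1 :: real)"
    unfolding schauder_def using assms by (intro integral_cong) (auto simp: haar_def)
  then show ?thesis using assms by simp
qed

lemma schauder_eq_tent:
  assumes t: "0 \<le> t"
  shows "schauder (int n) k t = 2 powr (- real n / 2) * tent (2 ^ n * t - real k)"
proof -
  define F where "F = (\<lambda>x. 2 powr (- real n / 2) * tent (2 ^ n * x - real k))"
  have scale: "2 powr (- real n / 2) * 2 ^ n = (2 powr (real n / 2) :: real)"
    by (simp add: powr_minus powr_half_sqrt field_simps flip: powr_realpow powr_add)
  have "(haar (int n) k has_integral (F t - F 0)) {0..t}"
  proof (rule fundamental_theorem_of_calculus_interior_strong)
    show "finite ((\<lambda>c. (c + real k) / 2 ^ n) ` {0, 1/2, 1})" by simp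
    show "0 \<le> t" by fact
    show "continuous_on {0..t} F" unfolding F_def by (intro continuous_intros)
  next
    fix x assume x: "x \<in> {0<..<t} - (\<lambda>c. (c + real k) / 2 ^ n) ` {0, 1/2, 1}"
    have "2 ^ n * x - real k \<notin> {0, 1/2, 1}"
    proof
      assume "2 ^ n * x - real k \<in> {0, 1/2, 1}"
      moreover have "x = (2 ^ n * x - real k + real k) / 2 ^ n" by simp
      ultimately show False using x by blast
    qed
    from DERIV_tent[OF this] have
      "((\<lambda>x. tent (2 ^ n * x - real k)) has_real_derivative haar_mother (2 ^ n * x - real k) * 2 ^ n) (at x)"
      by (rule DERIV_chain2) (auto intro!: derivative_eq_intros)
    from DERIV_cmult[OF this, of "2 powr (- real n / 2)"]
    have "(F has_real_derivative haar (int n) k x) (at x)"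
      by (simp add: F_def haar_def mult.left_commute mult.commute scale[symmetric] mult.assoc)
    then show "(F has_vector_derivative haar (int n) k x) (at x)"
      by (simp add: has_real_derivative_iff_has_vector_derivative)
  qed
  moreover have "F 0 = 0"
    using tent_of_int[of "- int k"] by (simp add: F_def)
  ultimately show ?thesis
    by (simp add: schauder_def integral_unique F_def)
qed

lemma schauder_0 [simp]: "schauder n k 0 = 0"
  by (simp add: schauder_def)

lemma level_cases:
  assumes "n \<in> {-1..}"
  obtains "n = -1" | m where "n = int m"
proof (cases "n = -1")
  case False
  with assms have "n = int (nat n)" by auto
  then show ?thesis using that by blast
qed (use that in blast)

lemma continuous_on_schauder:
  assumes "n \<in> {-1..}"
  shows "continuous_on {0..1} (schauder n k)"
  using assms
proof (cases rule: level_cases)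
  case 1
  have "continuous_on {0..1} (\<lambda>t :: real. t)" by (rule continuous_on_id)
  then show ?thesis
    unfolding 1 by (rule continuous_on_eq) (simp only: schauder_coarsest)
next
  case (2 m)
  have "continuous_on {0..1} (\<lambda>t. 2 powr (- real m / 2) * tent (2 ^ m * t - real k))"
    by (intro continuous_intros)
  then show ?thesis
    unfolding 2 by (rule continuous_on_eq) (simp add: schauder_eq_tent)
qed

lemma dyadic_eq: "dyadic (int n) k = real k / 2 ^ n"
  by (simp add: dyadic_def power_int_minus field_simps)

lemma dyadic_Suc: "dyadic (int n + 1) k = real k / 2 ^ Suc n"
  using dyadic_eq[of "Suc n" k] by (simp add: add.commute)

lemma level_index_nat [simp]: "level_index (int n) = {..<2 ^ n}"
  by (simp add: level_index_def)

lemma level_index_coarsest [simp]: "level_index (-1) = {0}"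
  by (simp add: level_index_def)

text \<open>
  With levels restricted to naturals and dyadic points written as fractions, a coefficient is an
  explicit second difference, a form to which ordinary field arithmetic applies.
\<close>

lemma schauder_coeff_nat:
  "schauder_coeff f (int n) k =
     2 powr (real n / 2) *
       (2 * f (real (2 * k + 1) / 2 ^ Suc n) - f (real k / 2 ^ n) - f (real (k + 1) / 2 ^ n))"
  unfolding schauder_coeff_def by (simp only: dyadic_eq dyadic_Suc) simp

lemma schauder_coeff_coarsest: "schauder_coeff f (-1) k = f 1 - f 0"
  by (simp add: schauder_coeff_def)

section \<open>Biorthogonality\<close>

lemma schauder_coeff_const: "schauder_coeff (\<lambda>t. c) n k = 0"
  by (simp add: schauder_coeff_def)

lemma schauder_coeff_add:
  "schauder_coeff (\<lambda>t. f t + g t) n k = schauder_coeff f n k + schauder_coeff g n k"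
  by (simp add: schauder_coeff_def algebra_simps)

lemma schauder_coeff_diff:
  "schauder_coeff (\<lambda>t. f t - g t) n k = schauder_coeff f n k - schauder_coeff g n k"
  by (simp add: schauder_coeff_def algebra_simps)

lemma schauder_coeff_cmult:
  "schauder_coeff (\<lambda>t. c * f t) n k = c * schauder_coeff f n k"
  by (simp add: schauder_coeff_def algebra_simps)

lemma schauder_coeff_sum:
  "schauder_coeff (\<lambda>t. \<Sum>x\<in>A. f x t) n k = (\<Sum>x\<in>A. schauder_coeff (f x) n k)"
  by (induction A rule: infinite_finite_induct) (simp_all add: schauder_coeff_const schauder_coeff_add)

lemma schauder_coeff_cong:
  assumes eq: "\<And>t. t \<in> {0..1} \<Longrightarrow> f t = g t" and n: "n \<in> {-1..}" and k: "k \<in> level_index n"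
  shows "schauder_coeff f n k = schauder_coeff g n k"
  using n
proof (cases rule: level_cases)
  case 1
  then show ?thesis using eq by (simp add: schauder_coeff_coarsest)
next
  case (2 m)
  with k have "k + 1 \<le> 2 ^ m" by simp
  then have "real (k + 1) \<le> real (2 ^ m)"
    by (simp only: of_nat_le_iff)
  then have k1: "real k + 1 \<le> 2 ^ m" by simp
  then have "real k \<le> 2 ^ m" "real (k + 1) \<le> 2 ^ m" "real (2 * k + 1) \<le> 2 ^ Suc m"
    unfolding power_Suc of_nat_add of_nat_mult by linarith+
  then have "real (2 * k + 1) / 2 ^ Suc m \<le> 1" "real k / 2 ^ m \<le> 1" "real (k + 1) / 2 ^ m \<le> 1"
    by (simp_all only: divide_le_eq_1_pos zero_less_power zero_less_numeral)
  then have "real (2 * k + 1) / 2 ^ Suc m \<in> {0..1}" "real k / 2 ^ m \<in> {0..1}" "real (k + 1) / 2 ^ m \<in> {0..1}"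
    unfolding atLeastAtMost_iff by (intro conjI; simp)+
  then show ?thesis using eq by (simp only: 2 schauder_coeff_nat)
qed

text \<open>
  The corners \<open>0\<close>, \<open>1/2\<close> and \<open>1\<close> of the tent, shifted by \<open>j\<close>, are multiples of \<open>1 / 2 ^ Suc d\<close>,
  so none of them lies inside the interval between \<open>k / 2 ^ Suc d\<close> and \<open>(k + 1) / 2 ^ Suc d\<close>.
  The tent is affine there and takes the mean of its end values at the midpoint. The exponent
  must be at least \<open>1\<close> for \<open>1/2\<close> to be on the grid.
\<close>

lemma tent_midpoint:
  "2 * tent (real (2 * k + 1) / 2 ^ Suc (Suc d) - real j)
     = tent (real k / 2 ^ Suc d - real j) + tent (real (k + 1) / 2 ^ Suc d - real j)"
proof -
  \<comment> \<open>In grid units the interval runs from \<open>i\<close> to \<open>i + 1\<close>, and the corners sit at \<open>0\<close>, \<open>D\<close> and \<open>2 * D\<close>.\<close>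
  define i where "i = int k - int j * 2 ^ Suc d"
  define D :: real where "D = 2 ^ d"
  have D: "D > 0" "D \<ge> 1" by (simp_all add: D_def)
  have i: "real k = of_int i + real j * (2 * D)" by (simp add: i_def D_def)
  have e1: "real (2 * k + 1) / 2 ^ Suc (Suc d) - real j = (2 * of_int i + 1) / (4 * D)"
    using D by (simp add: i D_def[symmetric] field_simps)
  have e2: "real k / 2 ^ Suc d - real j = of_int i / (2 * D)"
    using D by (simp add: i D_def[symmetric] field_simps)
  have e3: "real (k + 1) / 2 ^ Suc d - real j = (of_int i + 1) / (2 * D)"
    using D by (simp add: i D_def[symmetric] field_simps)
  have ints: "real_of_int (2 ^ d) = D" by (simp add: D_def)
  \<comment> \<open>The case split is exhaustive because \<open>i\<close> is an integer; the arithmetic takes place over the reals.\<close>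
  have "i + 1 \<le> 0 \<or> (0 \<le> i \<and> i + 1 \<le> 2 ^ d) \<or> (2 ^ d \<le> i \<and> i + 1 \<le> 2 * 2 ^ d) \<or> 2 * 2 ^ d \<le> i"
    by linarith
  then have "real_of_int (i + 1) \<le> of_int 0 \<or> (of_int 0 \<le> real_of_int i \<and> real_of_int (i + 1) \<le> of_int (2 ^ d))
      \<or> (of_int (2 ^ d) \<le> real_of_int i \<and> real_of_int (i + 1) \<le> of_int (2 * 2 ^ d))
      \<or> of_int (2 * 2 ^ d) \<le> real_of_int i"
    by (simp only: of_int_le_iff)
  then consider "real_of_int i + 1 \<le> 0" | "0 \<le> real_of_int i" "real_of_int i + 1 \<le> D"
    | "D \<le> real_of_int i" "real_of_int i + 1 \<le> 2 * D" | "2 * D \<le> real_of_int i"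
    unfolding of_int_mult of_int_add ints by auto
  then show ?thesis
    unfolding e1 e2 e3
  proof cases
    case 1
    then have "(2 * real_of_int i + 1) / (4 * D) \<le> 0" "real_of_int i / (2 * D) \<le> 0" "(real_of_int i + 1) / (2 * D) \<le> 0"
      using D by (auto simp: divide_le_eq)
    then show "2 * tent ((2 * of_int i + 1) / (4 * D)) = tent (of_int i / (2 * D)) + tent ((of_int i + 1) / (2 * D))"
      by (simp add: tent_def)
  next
    case 2
    have *: "tent x = x" if "0 \<le> x" "x \<le> 1/2" for x using that by (simp add: tent_def)
    show "2 * tent ((2 * of_int i + 1) / (4 * D)) = tent (of_int i / (2 * D)) + tent ((of_int i + 1) / (2 * D))"
      using 2 D by (subst (1 2 3) *) (auto simp: field_simps)
  next
    case 3
    have *: "tent x = 1 - x" if "1/2 \<le> x" "x \<le> 1" for x using that by (simp add: tent_def)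
    show "2 * tent ((2 * of_int i + 1) / (4 * D)) = tent (of_int i / (2 * D)) + tent ((of_int i + 1) / (2 * D))"
      using 3 D by (subst (1 2 3) *) (auto simp: field_simps)
  next
    case 4
    have *: "tent x = 0" if "1 \<le> x" for x using that by (simp add: tent_def)
    show "2 * tent ((2 * of_int i + 1) / (4 * D)) = tent (of_int i / (2 * D)) + tent ((of_int i + 1) / (2 * D))"
      using 4 D by (subst (1 2 3) *) (auto simp: field_simps)
  qed
qed

text \<open>
  Let \<open>m, n \<ge> 0\<close>. If \<open>n < m\<close>, the three sampling points of the second difference are zeros of the
  tent. If \<open>n = m\<close>, its end points are zeros, and its midpoint is the apex of the tent precisely
  when the positions agree. If \<open>n > m\<close>, the tent is affine between its end points. Level \<open>-1\<close> is
  the function \<open>t\<close>, which second differences annihilate, while its increment over the unit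
  interval is \<open>1\<close>.
\<close>

lemma schauder_coeff_schauder:
  assumes m: "m \<in> {-1..}" and j: "j \<in> level_index m"
    and n: "n \<in> {-1..}" and k: "k \<in> level_index n"
  shows "schauder_coeff (schauder m j) n k = (if m = n \<and> j = k then 1 else 0)"
  using m
proof (cases rule: level_cases)
  case m: 1
  have "schauder_coeff (schauder m j) n k = schauder_coeff (\<lambda>t. t) n k"
    using n k m by (intro schauder_coeff_cong) (auto simp: schauder_coarsest)
  also have "\<dots> = (if n = -1 then 1 else 0)"
    using n by (cases rule: level_cases) (simp_all add: schauder_coeff_coarsest schauder_coeff_nat field_simps)
  finally show ?thesis using m j k by auto
next
  case m: (2 m')
  have e: "schauder m j t = 2 powr (- real m' / 2) * tent (2 ^ m' * t - real j)" if "0 \<le> t" for t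
    using m that by (simp add: schauder_eq_tent)
  have int0: "tent (2 ^ m' * (real i / 2 ^ l) - real j) = 0" if "l \<le> m'" for i l
  proof -
    have "(2 :: real) ^ m' = 2 ^ l * 2 ^ (m' - l)"
      using that by (simp flip: power_add)
    then have "2 ^ m' * (real i / 2 ^ l) - real j = of_int (int i * 2 ^ (m' - l) - int j)"
      by simp
    then show ?thesis by (simp only: tent_of_int)
  qed
  from n show ?thesis
  proof (cases rule: level_cases)
    case 1
    then show ?thesis
      using m int0[of 0 1] e[of 1] by (simp add: schauder_coeff_coarsest)
  next
    case n: (2 n')
    define T where "T x = tent (2 ^ m' * x - real j)" for x
    have nonneg: "0 \<le> real i / 2 ^ l" for i l by simp
    have coeff: "schauder_coeff (schauder m j) n k = 2 powr (real n' / 2) * 2 powr (- real m' / 2) *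
        (2 * T (real (2 * k + 1) / 2 ^ Suc n') - T (real k / 2 ^ n') - T (real (k + 1) / 2 ^ n'))"
      unfolding n schauder_coeff_nat e[OF nonneg] T_def by (simp only: algebra_simps)
    consider "n' < m'" | "n' = m'" | "m' < n'" by linarith
    then show ?thesis
    proof cases
      case 1
      then have zero: "T (real i / 2 ^ n') = 0" "T (real i / 2 ^ Suc n') = 0" for i
        unfolding T_def by (intro int0; linarith)+
      have "schauder_coeff (schauder m j) n k = 0"
        unfolding coeff zero by simp
      moreover have "m \<noteq> n" using 1 m n by simp
      ultimately show ?thesis by simp
    next
      case 2
      \<comment> \<open>Midpoints are half-integers in the scale of the tent, and \<open>1/2\<close> is the only half-integer in its support.\<close>
      have half: "2 ^ m' * (real (2 * k + 1) / 2 ^ Suc m') - real j = of_int (int k - int j) + 1 / 2"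
        by (simp add: field_simps)
      have "tent (of_int i + 1 / 2) = (if i = 0 then 1 / 2 else 0)" for i
      proof -
        consider "i \<le> -1" | "i = 0" | "i \<ge> 1" by linarith
        then show ?thesis by cases (auto simp: tent_def)
      qed
      then have mid: "T (real (2 * k + 1) / 2 ^ Suc n') = (if j = k then 1 / 2 else 0)"
        unfolding T_def 2 half by (simp only: right_minus_eq of_nat_eq_iff eq_commute[of j])
      have ends: "T (real i / 2 ^ n') = 0" for i
        unfolding T_def 2 by (rule int0) (rule order_refl)
      have "2 powr (real n' / 2) * 2 powr (- real m' / 2) = (1 :: real)"
        unfolding 2 powr_add[symmetric] by simp
      then have "schauder_coeff (schauder m j) n k = (if j = k then 1 else 0)"
        unfolding coeff mid ends by simp
      moreover have "m = n" using 2 m n by simp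
      ultimately show ?thesis by simp
    next
      case 3
      then obtain d where "n' = Suc (m' + d)"
        using less_imp_Suc_add by blast
      then have d: "n' = m' + Suc d" "Suc n' = m' + Suc (Suc d)" by simp_all
      have shift: "2 ^ m' * (x / 2 ^ (m' + l)) = x / 2 ^ l" for x :: real and l
        by (simp add: power_add)
      have mid: "2 * T (real (2 * k + 1) / 2 ^ Suc n') = T (real k / 2 ^ n') + T (real (k + 1) / 2 ^ n')"
        unfolding T_def d(2) unfolding d(1) shift by (rule tent_midpoint)
      have "schauder_coeff (schauder m j) n k = 0"
        unfolding coeff mid by simp
      moreover have "m \<noteq> n" using 3 m n by simp
      ultimately show ?thesis by simp
    qed
  qed
qed

lemma schauder_coeff_schauder_sum:
  assumes n: "n \<in> {-1..}" and k: "k \<in> level_index n"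
  shows "schauder_coeff (schauder_sum N c a) n k = (if n < int N then a n k else 0)"
proof -
  have fin: "finite (level_index m)" for m by (simp add: level_index_def)
  have "schauder_coeff (schauder_sum N c a) n k =
      (\<Sum>m\<in>{-1..int N - 1}. \<Sum>j\<in>level_index m. a m j * schauder_coeff (schauder m j) n k)"
    unfolding schauder_sum_def[abs_def]
    by (simp add: schauder_coeff_add schauder_coeff_const schauder_coeff_sum schauder_coeff_cmult)
  also have "\<dots> = (\<Sum>m\<in>{-1..int N - 1}. \<Sum>j\<in>level_index m. if j = k then if m = n then a m j else 0 else 0)"
    using n k by (intro sum.cong refl) (auto simp: schauder_coeff_schauder)
  also have "\<dots> = (\<Sum>m\<in>{-1..int N - 1}. if m = n then a n k else 0)"
    using k by (intro sum.cong refl) (auto simp: fin)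
  also have "\<dots> = (if n < int N then a n k else 0)"
    using n by auto
  finally show ?thesis .
qed

lemma continuous_on_schauder_sum: "continuous_on {0..1} (schauder_sum N c a)"
  unfolding schauder_sum_def[abs_def]
  by (intro continuous_on_add continuous_on_const continuous_on_sum continuous_on_mult continuous_on_schauder) auto

lemma schauder_coeff_remainder:
  assumes "n \<in> {-1..}" "k \<in> level_index n"
  shows "schauder_coeff (\<lambda>t. f t - schauder_trunc N f t) n k = (if n < int N then 0 else schauder_coeff f n k)"
  unfolding schauder_trunc_def schauder_coeff_diff schauder_coeff_schauder_sum[OF assms] by simp

section \<open>The uniform norm is controlled by the Schauder tail\<close>

text \<open>
  The \<open>m\<close>th summand of the Schauder tail. Giving it a name exposes a tail as the sum of one
  fixed sequence over a final segment of the levels.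
\<close>

definition level_sup :: "(real \<Rightarrow> real) \<Rightarrow> nat \<Rightarrow> ennreal" where
  "level_sup f m = ennreal (2 powr (- real m / 2)) *
     (SUP k\<in>level_index (int m). ennreal \<bar>schauder_coeff f (int m) k\<bar>)"

lemma schauder_tail_eq: "schauder_tail f n = (\<Sum>\<^sub>\<infinity>m\<in>{n..}. level_sup f m)"
  by (simp add: schauder_tail_def level_sup_def)

lemma level_sup_upper:
  assumes "k < 2 ^ m"
  shows "ennreal (2 powr (- real m / 2) * \<bar>schauder_coeff f (int m) k\<bar>) \<le> level_sup f m"
proof -
  have "ennreal \<bar>schauder_coeff f (int m) k\<bar> \<le> (SUP k\<in>level_index (int m). ennreal \<bar>schauder_coeff f (int m) k\<bar>)"
    using assms by (intro SUP_upper) simp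
  then show ?thesis
    unfolding level_sup_def by (subst ennreal_mult) (simp_all only: powr_ge_zero abs_ge_zero mult_left_mono zero_le)
qed

lemma level_sup_cong:
  assumes "\<And>k. k \<in> level_index (int m) \<Longrightarrow> schauder_coeff f (int m) k = schauder_coeff g (int m) k"
  shows "level_sup f m = level_sup g m"
  unfolding level_sup_def using assms by (intro arg_cong2[where f = "(*)"] refl SUP_cong) simp_all

lemma level_sup_eq_0:
  assumes "\<And>k. k \<in> level_index (int m) \<Longrightarrow> schauder_coeff f (int m) k = 0"
  shows "level_sup f m = 0"
proof -
  have "(SUP k\<in>level_index (int m). ennreal \<bar>schauder_coeff f (int m) k\<bar>) \<le> 0"
    using assms by (intro SUP_least) simp
  then show ?thesis
    by (simp add: level_sup_def)
qed

lemma level_sup_finite: "level_sup f m < \<infinity>"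
proof -
  have "(SUP k\<in>level_index (int m). ennreal \<bar>schauder_coeff f (int m) k\<bar>)
      \<le> (\<Sum>k\<in>level_index (int m). ennreal \<bar>schauder_coeff f (int m) k\<bar>)"
    by (intro SUP_least member_le_sum) auto
  also have "\<dots> < \<infinity>" by simp
  finally have "(SUP k\<in>level_index (int m). ennreal \<bar>schauder_coeff f (int m) k\<bar>) < \<infinity>" .
  then show ?thesis by (auto simp: level_sup_def ennreal_mult_less_top)
qed

text \<open>
  The dyadic points that are new at level \<open>n + 1\<close> are midpoints of level-\<open>n\<close> intervals, and there
  \<open>2 g(mid) = 2\<^bsup>-n/2\<^esup> \<theta>\<^sub>n\<^sub>,\<^sub>k + g(left) + g(right)\<close>. So the bound grows by at most the level-\<open>n\<close> term
  of the tail.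
\<close>

lemma abs_at_dyadic_le:
  assumes "k \<le> 2 ^ n"
  shows "ennreal \<bar>g (real k / 2 ^ n)\<bar> \<le> ennreal (max \<bar>g 0\<bar> \<bar>g 1\<bar>) + (\<Sum>m<n. level_sup g m)"
  using assms
proof (induction n arbitrary: k)
  case 0
  then have "k = 0 \<or> k = 1" by auto
  then show ?case by (auto intro!: ennreal_leI)
next
  case (Suc n)
  let ?B = "ennreal (max \<bar>g 0\<bar> \<bar>g 1\<bar>) + (\<Sum>m<n. level_sup g m)"
  have mono: "?B \<le> ennreal (max \<bar>g 0\<bar> \<bar>g 1\<bar>) + (\<Sum>m<Suc n. level_sup g m)"
    by (intro add_left_mono) simp
  show ?case
  proof (cases "even k")
    case True
    then obtain j where j: "k = 2 * j" by blast
    with Suc.prems have "j \<le> 2 ^ n" by simp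
    from Suc.IH[OF this] mono show ?thesis by (auto simp: j intro: order_trans)
  next
    case False
    then obtain j where j: "k = 2 * j + 1" by (elim oddE)
    with Suc.prems have jn: "j < 2 ^ n" by auto
    define l r where "l = g (real j / 2 ^ n)" and "r = g (real (j + 1) / 2 ^ n)"
    define \<theta> where "\<theta> = 2 powr (- real n / 2) * schauder_coeff g (int n) j"
    have "\<theta> = 2 * g (real k / 2 ^ Suc n) - l - r"
      unfolding \<theta>_def schauder_coeff_nat l_def r_def j
      by (simp add: powr_minus)
    then have "\<bar>g (real k / 2 ^ Suc n)\<bar> \<le> max \<bar>l\<bar> \<bar>r\<bar> + \<bar>\<theta>\<bar>"
      by linarith
    then have "ennreal \<bar>g (real k / 2 ^ Suc n)\<bar> \<le> ennreal (max \<bar>l\<bar> \<bar>r\<bar>) + ennreal \<bar>\<theta>\<bar>"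
      by (simp add: ennreal_leI flip: ennreal_plus)
    also have "\<dots> \<le> ?B + level_sup g n"
    proof (rule add_mono)
      show "ennreal (max \<bar>l\<bar> \<bar>r\<bar>) \<le> ?B"
        using Suc.IH[of j] Suc.IH[of "j + 1"] jn by (simp add: l_def r_def max_def)
      show "ennreal \<bar>\<theta>\<bar> \<le> level_sup g n"
        using level_sup_upper[OF jn, of g] by (simp add: \<theta>_def abs_mult)
    qed
    finally show ?thesis by (simp add: add.assoc)
  qed
qed

text \<open>
  Dyadic points are dense and \<open>g\<close> is continuous, so the bound at dyadic points, which is uniform
  in the level, carries over to every point.
\<close>

lemma sup_norm_le_schauder_tail:
  assumes cont: "continuous_on {0..1} g"
  shows "sup_norm g \<le> ennreal (max \<bar>g 0\<bar> \<bar>g 1\<bar>) + schauder_tail g 0"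
  unfolding sup_norm_def
proof (rule SUP_least)
  fix t :: real assume t: "t \<in> {0..1}"
  define k where "k n = nat \<lfloor>2 ^ n * t\<rfloor>" for n
  have k: "real (k n) = of_int \<lfloor>2 ^ n * t\<rfloor>" for n
    using t by (simp add: k_def)
  have kle: "real (k n) \<le> 2 ^ n * t" "2 ^ n * t - 1 \<le> real (k n)" for n
    unfolding k by linarith+
  have bnds: "real (k n) / 2 ^ n \<le> t" "t - (1/2) ^ n \<le> real (k n) / 2 ^ n" for n
  proof -
    show "real (k n) / 2 ^ n \<le> t"
      using kle(1)[of n] by (simp add: field_simps)
    have "t - (1/2) ^ n = (2 ^ n * t - 1) / 2 ^ n"
      by (simp add: diff_divide_distrib power_one_over)
    also have "\<dots> \<le> real (k n) / 2 ^ n"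
      by (intro divide_right_mono kle) simp
    finally show "t - (1/2) ^ n \<le> real (k n) / 2 ^ n" .
  qed
  have "(\<lambda>n. t - (1/2) ^ n) \<longlonglongrightarrow> t - 0"
    by (rule tendsto_diff[OF tendsto_const LIMSEQ_realpow_zero]) simp_all
  then have lower: "(\<lambda>n. t - (1/2) ^ n) \<longlonglongrightarrow> t"
    by (simp only: diff_zero)
  have lim: "(\<lambda>n. real (k n) / 2 ^ n) \<longlonglongrightarrow> t"
    by (rule tendsto_sandwich[OF always_eventually always_eventually lower tendsto_const]) (blast intro: bnds)+
  have in01: "real (k n) / 2 ^ n \<in> {0..1}" for n
  proof -
    have "real (k n) / 2 ^ n \<le> 1"
      using bnds(1)[of n] t unfolding atLeastAtMost_iff by linarith
    moreover have "0 \<le> real (k n) / 2 ^ n" by simp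
    ultimately show ?thesis by (simp only: atLeastAtMost_iff)
  qed
  have "(\<lambda>n. g (real (k n) / 2 ^ n)) \<longlonglongrightarrow> g t"
    using continuous_on_tendsto_compose[OF cont lim t] in01 by (auto intro: always_eventually)
  then have "(\<lambda>n. ennreal \<bar>g (real (k n) / 2 ^ n)\<bar>) \<longlonglongrightarrow> ennreal \<bar>g t\<bar>"
    by (intro tendsto_ennrealI tendsto_rabs)
  moreover have "ennreal \<bar>g (real (k n) / 2 ^ n)\<bar> \<le> ennreal (max \<bar>g 0\<bar> \<bar>g 1\<bar>) + schauder_tail g 0" for n
  proof -
    have "k n \<le> 2 ^ n"
      using in01[of n] by simp
    then have "ennreal \<bar>g (real (k n) / 2 ^ n)\<bar> \<le> ennreal (max \<bar>g 0\<bar> \<bar>g 1\<bar>) + (\<Sum>m<n. level_sup g m)"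
      by (rule abs_at_dyadic_le)
    also have "\<dots> \<le> ennreal (max \<bar>g 0\<bar> \<bar>g 1\<bar>) + schauder_tail g 0"
      using infsum_mono_neutral[of "level_sup g" "{..<n}" "level_sup g" "{0..}"]
      by (intro add_left_mono) (auto simp: schauder_tail_eq)
    finally show ?thesis .
  qed
  ultimately show "ennreal \<bar>g t\<bar> \<le> ennreal (max \<bar>g 0\<bar> \<bar>g 1\<bar>) + schauder_tail g 0"
    by (meson LIMSEQ_le_const2)
qed

section \<open>Energy norms of remainders and finite expansions\<close>

lemma level_energy_cong:
  assumes "\<And>k. k \<in> level_index n \<Longrightarrow> schauder_coeff f n k = schauder_coeff g n k"
  shows "level_energy p f n = level_energy p g n"
  using assms by (auto simp: level_energy_def)

lemma level_energy_eq_0: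
  assumes "\<And>k. k \<in> level_index n \<Longrightarrow> schauder_coeff f n k = 0"
  shows "level_energy p f n = 0"
  using assms by (auto simp: level_energy_def)

lemma level_energy_remainder:
  assumes "n \<in> {-1..}"
  shows "level_energy p (\<lambda>t. f t - schauder_trunc N f t) n = (if n < int N then 0 else level_energy p f n)"
  using assms by (auto simp: schauder_coeff_remainder intro!: level_energy_cong level_energy_eq_0)

lemma level_sup_remainder:
  "level_sup (\<lambda>t. f t - schauder_trunc N f t) m = (if m < N then 0 else level_sup f m)"
  by (auto simp: schauder_coeff_remainder simp del: level_index_nat intro!: level_sup_cong level_sup_eq_0)

text \<open>
  Removing the levels below \<open>N\<close> freezes the tail sequence at its value at \<open>N\<close> for all \<open>n \<le> N\<close>.
  In particular this part does not become \<open>0\<close> for small \<open>n\<close>, and its decay rests on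
  \<open>schauder_tail_tendsto_0\<close>.
\<close>

lemma schauder_tail_remainder:
  "schauder_tail (\<lambda>t. f t - schauder_trunc N f t) n = schauder_tail f (max n N)"
  unfolding schauder_tail_eq level_sup_remainder
  by (intro infsum_cong_neutral) auto

lemma schauder_tail_antimono: "m \<le> n \<Longrightarrow> schauder_tail f n \<le> schauder_tail f m"
  unfolding schauder_tail_eq by (intro infsum_mono_neutral) auto

lemma schauder_tail_tendsto_0:
  assumes "schauder_tail f 0 < \<infinity>"
  shows "schauder_tail f \<longlonglongrightarrow> 0"
proof -
  have "(\<lambda>N. \<Sum>\<^sub>\<infinity>m. if N \<le> m then level_sup f m else 0) \<longlonglongrightarrow> 0"
  proof (rule infsum_ennreal_dominated_tendsto_0[where w = "level_sup f"])
    show "(\<Sum>\<^sub>\<infinity>m. level_sup f m) < \<infinity>"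
      using assms by (simp add: schauder_tail_eq)
    fix m
    have "\<forall>\<^sub>F N in sequentially. (if N \<le> m then level_sup f m else 0) = 0"
      using eventually_gt_at_top[of m] by eventually_elim simp
    then show "(\<lambda>N. if N \<le> m then level_sup f m else 0) \<longlonglongrightarrow> 0"
      by (rule tendsto_eventually)
  qed simp
  moreover have "schauder_tail f N = (\<Sum>\<^sub>\<infinity>m. if N \<le> m then level_sup f m else 0)" for N
    unfolding schauder_tail_eq by (intro infsum_cong_neutral) auto
  ultimately show ?thesis by presburger
qed

text \<open>
  The remainder vanishes at \<open>0\<close> because all Schauder functions do, and at \<open>1\<close> because its
  increment over the unit interval is its coefficient of level \<open>-1\<close>, which the truncation cancels.
\<close>

lemma sup_norm_remainder_le:
  assumes "continuous_on {0..1} f"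
  shows "sup_norm (\<lambda>t. f t - schauder_trunc N f t) \<le> schauder_tail f N"
proof -
  let ?g = "\<lambda>t. f t - schauder_trunc N f t"
  have "?g 0 = 0" by (simp add: schauder_trunc_def schauder_sum_def)
  moreover have "?g 1 - ?g 0 = 0"
    using schauder_coeff_remainder[of "-1" 0 f N] by (simp add: schauder_coeff_coarsest)
  moreover have "continuous_on {0..1} ?g"
    unfolding schauder_trunc_def by (intro continuous_intros assms continuous_on_schauder_sum)
  ultimately show ?thesis
    using sup_norm_le_schauder_tail[of ?g] by (simp add: schauder_tail_remainder)
qed

lemma energy_norm_remainder_tendsto_0:
  assumes p: "0 < p" and f: "f \<in> energy_space p"
  shows "(\<lambda>N. energy_norm p (\<lambda>t. f t - schauder_trunc N f t)) \<longlonglongrightarrow> 0"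
proof -
  let ?g = "\<lambda>N t. f t - schauder_trunc N f t"
  have cont: "continuous_on {0..1} f"
    and energy: "lp_norm p {-1..} (\<lambda>n. ennreal (level_energy p f n)) < \<infinity>"
    and tail: "lp_norm p UNIV (schauder_tail f) < \<infinity>"
    using f by (auto simp: energy_space_def energy_norm_def)
  have "schauder_tail f 0 < \<infinity>"
    using tail by (rule lp_norm_finite_imp_finite) simp
  then have tail0: "schauder_tail f \<longlonglongrightarrow> 0"
    by (rule schauder_tail_tendsto_0)
  have "(\<lambda>N. sup_norm (?g N)) \<longlonglongrightarrow> 0"
    by (rule tendsto_sandwich[OF _ _ tendsto_const tail0])
       (auto intro!: always_eventually sup_norm_remainder_le cont)
  moreover have "(\<lambda>N. lp_norm p {-1..} (\<lambda>n. ennreal (level_energy p (?g N) n))) \<longlonglongrightarrow> 0"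
  proof (rule lp_norm_dominated_tendsto_0[OF p _ energy])
    fix n :: int assume n: "n \<in> {-1..}"
    show "ennreal (level_energy p (?g N) n) \<le> ennreal (level_energy p f n)" for N
      using n by (simp add: level_energy_remainder)
    have "\<forall>\<^sub>F N in sequentially. ennreal (level_energy p (?g N) n) = 0"
      using eventually_gt_at_top[of "nat n"] by eventually_elim (use n in \<open>simp add: level_energy_remainder\<close>)
    then show "(\<lambda>N. ennreal (level_energy p (?g N) n)) \<longlonglongrightarrow> 0"
      by (rule tendsto_eventually)
  qed
  moreover have "(\<lambda>N. lp_norm p UNIV (schauder_tail (?g N))) \<longlonglongrightarrow> 0"
  proof (rule lp_norm_dominated_tendsto_0[OF p _ tail])
    fix n
    show "schauder_tail (?g N) n \<le> schauder_tail f n" for N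
      by (simp add: schauder_tail_remainder schauder_tail_antimono)
    show "(\<lambda>N. schauder_tail (?g N) n) \<longlonglongrightarrow> 0"
      by (rule tendsto_sandwich[OF _ _ tendsto_const tail0])
         (auto simp: schauder_tail_remainder intro!: always_eventually schauder_tail_antimono)
  qed
  ultimately have "(\<lambda>N. energy_norm p (?g N)) \<longlonglongrightarrow> 0 + 0 + 0"
    unfolding energy_norm_def by (intro tendsto_add)
  then show ?thesis by simp
qed

lemma sup_norm_finite:
  assumes "continuous_on {0..1} g"
  shows "sup_norm g < \<infinity>"
proof -
  have "bounded (g ` {0..1})"
    using assms by (intro compact_imp_bounded compact_continuous_image) auto
  then obtain B where "\<forall>t\<in>{0..1}. \<bar>g t\<bar> \<le> B"
    by (auto simp: bounded_iff)
  then have "sup_norm g \<le> ennreal B"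
    unfolding sup_norm_def by (intro SUP_least ennreal_leI) blast
  then show ?thesis by (simp add: less_top le_less_trans)
qed

text \<open>
  Membership ties \<open>g\<close> to its expansion on the unit interval only. That is enough, because the
  coefficients sample no other points.
\<close>

lemma finite_schauder_expansion_in_energy_space:
  assumes "g \<in> finite_schauder_expansions"
  shows "g \<in> energy_space p"
proof -
  obtain N c a where g: "\<And>t. t \<in> {0..1} \<Longrightarrow> g t = schauder_sum N c a t"
    using assms unfolding finite_schauder_expansions_def by blast
  have cont: "continuous_on {0..1} g"
    using continuous_on_schauder_sum by (rule continuous_on_eq) (simp only: g)
  have vanish: "schauder_coeff g n k = 0" if "int N \<le> n" "k \<in> level_index n" for n k
  proof -
    have n: "n \<in> {-1..}" using that by auto
    have "schauder_coeff g n k = schauder_coeff (schauder_sum N c a) n k"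
      using n that by (intro schauder_coeff_cong g)
    then show ?thesis using n that by (simp add: schauder_coeff_schauder_sum)
  qed
  have ls: "level_sup g m = 0" if "N \<le> m" for m
    using that by (intro level_sup_eq_0 vanish) auto
  have fin: "schauder_tail g n < \<infinity>" for n
  proof -
    have "schauder_tail g n = (\<Sum>\<^sub>\<infinity>m\<in>{n..<N}. level_sup g m)"
      unfolding schauder_tail_eq using ls by (intro infsum_cong_neutral) auto
    also have "\<dots> < \<infinity>"
      using level_sup_finite[of g] by simp
    finally show ?thesis .
  qed
  have zero: "schauder_tail g n = 0" if "N \<le> n" for n
    unfolding schauder_tail_eq using that ls by (intro infsum_0) auto
  have "lp_norm p UNIV (schauder_tail g) < \<infinity>"
    using fin zero by (intro lp_norm_finite_support[of "{..<N}"]) auto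
  moreover have "lp_norm p {-1..} (\<lambda>n. ennreal (level_energy p g n)) < \<infinity>"
    by (intro lp_norm_finite_support[of "{-1..<int N}"]) (auto simp: level_energy_eq_0 vanish)
  ultimately show ?thesis
    using cont sup_norm_finite[OF cont] by (auto simp: energy_space_def energy_norm_def)
qed

theorem proposition3p24:
  fixes p :: real
  assumes "p > 1"
  shows "(\<forall>f\<in>energy_space p.
            (\<lambda>N. energy_norm p (\<lambda>t. f t - schauder_trunc N f t)) \<longlonglongrightarrow> 0)
       \<and> finite_schauder_expansions \<subseteq> energy_space p
       \<and> (\<forall>f\<in>energy_space p. \<forall>\<epsilon>>0. \<exists>g\<in>finite_schauder_expansions.
            energy_norm p (\<lambda>t. f t - g t) < ennreal \<epsilon>)"
proof (intro conjI ballI subsetI allI impI)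
  fix f assume f: "f \<in> energy_space p"
  show lim: "(\<lambda>N. energy_norm p (\<lambda>t. f t - schauder_trunc N f t)) \<longlonglongrightarrow> 0"
    using assms f by (intro energy_norm_remainder_tendsto_0) auto
  fix \<epsilon> :: real assume "\<epsilon> > 0"
  then have "\<forall>\<^sub>F N in sequentially. energy_norm p (\<lambda>t. f t - schauder_trunc N f t) < ennreal \<epsilon>"
    by (intro order_tendstoD(2)[OF lim]) simp
  then obtain N where N: "energy_norm p (\<lambda>t. f t - schauder_trunc N f t) < ennreal \<epsilon>"
    by (meson eventually_happens trivial_limit_sequentially)
  have "schauder_trunc N f \<in> finite_schauder_expansions"
    by (auto simp: finite_schauder_expansions_def schauder_trunc_def)
  with N show "\<exists>g\<in>finite_schauder_expansions. energy_norm p (\<lambda>t. f t - g t) < ennreal \<epsilon>"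
    by blast
qed (rule finite_schauder_expansion_in_energy_space)

end
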